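(* Let $\Gamma\subset\Delta^+$ be an antichain. Then (i) the elements of $\Gamma$ are linearly independent, and hence $\#(\Gamma)\le\operatorname{rk}\mathfrak g$; (ii) if $\#(\Gamma)=\operatorname{rk}\mathfrak g$, then $\Gamma=\Pi$.
   Context: $\Delta$ is the (reduced, irreducible, crystallographic) root system of a simple Lie algebra $\mathfrak g$, with positive roots $\Delta^+$ and set of simple roots $\Pi=\{\alpha_1,\dots,\alpha_p\}$, $p=\operatorname{rk}\mathfrak g$. $\Delta^+$ is partially ordered by $\mu\preccurlyeq\nu$ iff $\nu-\mu\in Q^+=\{\sum_i n_i\alpha_i\mid n_i\in\mathbb Z_{\ge0}\}$. An antichain is a subset of pairwise incomparable elements of $(\Delta^+,\preccurlyeq)$. *)

theory Defs
  imports "HOL-Analysis.Analysis"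
begin

definition root_reflection :: "'a::euclidean_space \<Rightarrow> 'a \<Rightarrow> 'a" where
  "root_reflection \<alpha> \<beta> = \<beta> - (2 * (\<beta> \<bullet> \<alpha>) / (\<alpha> \<bullet> \<alpha>)) *\<^sub>R \<alpha>"

definition root_system :: "'a::euclidean_space set \<Rightarrow> bool" where
  "root_system \<Delta> \<longleftrightarrow>
     finite \<Delta> \<and> 0 \<notin> \<Delta> \<and> span \<Delta> = UNIV \<and>
     (\<forall>\<alpha>\<in>\<Delta>. \<forall>\<beta>\<in>\<Delta>. root_reflection \<alpha> \<beta> \<in> \<Delta>)"

definition crystallographic :: "'a::euclidean_space set \<Rightarrow> bool" where
  "crystallographic \<Delta> \<longleftrightarrow> (\<forall>\<alpha>\<in>\<Delta>. \<forall>\<beta>\<in>\<Delta>. 2 * (\<beta> \<bullet> \<alpha>) / (\<alpha> \<bullet> \<alpha>) \<in> \<int>)"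

definition reduced :: "'a::euclidean_space set \<Rightarrow> bool" where
  "reduced \<Delta> \<longleftrightarrow> (\<forall>\<alpha>\<in>\<Delta>. \<forall>c. c *\<^sub>R \<alpha> \<in> \<Delta> \<longrightarrow> c = 1 \<or> c = -1)"

definition irreducible_roots :: "'a::euclidean_space set \<Rightarrow> bool" where
  "irreducible_roots \<Delta> \<longleftrightarrow>
     \<Delta> \<noteq> {} \<and>
     \<not> (\<exists>A B. A \<noteq> {} \<and> B \<noteq> {} \<and> A \<inter> B = {} \<and> A \<union> B = \<Delta> \<and> (\<forall>\<alpha>\<in>A. \<forall>\<beta>\<in>B. \<alpha> \<bullet> \<beta> = 0))"

text \<open>The root systems of simple complex Lie algebras, as abstract root systems in the
  Euclidean space that they span.\<close>

definition simple_lie_root_system :: "'a::euclidean_space set \<Rightarrow> bool" where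
  "simple_lie_root_system \<Delta> \<longleftrightarrow>
     root_system \<Delta> \<and> reduced \<Delta> \<and> irreducible_roots \<Delta> \<and> crystallographic \<Delta>"

text \<open>The rank of the Lie algebra is the dimension of a Cartan subalgebra, that is, of the
  space spanned by the roots.\<close>

definition root_rank :: "'a::euclidean_space set \<Rightarrow> nat" where
  "root_rank \<Delta> = dim (span \<Delta>)"

definition Q_plus :: "'a::euclidean_space set \<Rightarrow> 'a set" where
  "Q_plus S = range (\<lambda>n :: 'a \<Rightarrow> nat. \<Sum>\<alpha>\<in>S. real (n \<alpha>) *\<^sub>R \<alpha>)"

definition simple_roots :: "'a::euclidean_space set \<Rightarrow> 'a set \<Rightarrow> bool" where
  "simple_roots \<Delta> S \<longleftrightarrow>
     S \<subseteq> \<Delta> \<and> independent S \<and> span S = span \<Delta> \<and>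
     (\<forall>\<beta>\<in>\<Delta>. \<beta> \<in> Q_plus S \<or> - \<beta> \<in> Q_plus S)"

text \<open>Choosing simple roots is equivalent to choosing positive roots; the simple roots are
  taken as the primitive datum.\<close>

definition positive_roots :: "'a::euclidean_space set \<Rightarrow> 'a set \<Rightarrow> 'a set" where
  "positive_roots \<Delta> S = \<Delta> \<inter> Q_plus S"

definition root_le :: "'a::euclidean_space set \<Rightarrow> 'a \<Rightarrow> 'a \<Rightarrow> bool" where
  "root_le S \<mu> \<nu> \<longleftrightarrow> \<nu> - \<mu> \<in> Q_plus S"

definition root_antichain :: "'a::euclidean_space set \<Rightarrow> 'a set \<Rightarrow> 'a set \<Rightarrow> bool" where
  "root_antichain \<Delta> S \<Gamma> \<longleftrightarrow>
     \<Gamma> \<subseteq> positive_roots \<Delta> S \<and>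
     pairwise (\<lambda>\<mu> \<nu>. \<not> root_le S \<mu> \<nu> \<and> \<not> root_le S \<nu> \<mu>) \<Gamma>"

end

(* Two roots with positive inner product differ by a root, so an antichain \<Gamma> of positive roots is
   pairwise obtuse; lying in an open half-space, it is independent.

   Suppose that \<Gamma> has as many elements as S, and let x0 take the value 1 on \<Gamma>. Call a positive
   root low (the set "below") if it is not above any element of \<Gamma>. Cancelling pairs with positive inner product
   in an equation between sums of roots shows that x0 < 1 on low roots, since these are rational
   combinations of \<Gamma>. As \<Gamma> is a maximal obtuse set, each low root \<beta> has a low partner
   \<gamma> - \<beta> with \<gamma> in \<Gamma>, so that x0 > 0 on low roots and hence on all positive roots.
   Next, -x0 lies in the orbit of x0 under the reflections in \<Gamma>, as x0 is the shortest
   vector with values at least 1 on \<Gamma>; hence 2 x0 is integral on roots and x0 = 1/2 on low roots.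
   Therefore every element of \<Gamma> - S is a sum of two adjacent elements of S - \<Gamma>, but a forest
   with n > 0 vertices has fewer than n edges. *)

theory Submission
  imports Defs "HOL-Library.Multiset"
begin

section \<open>Linear algebra of obtuse families\<close>

lemma ex_inner_eq_1:
  fixes B :: "'a::euclidean_space set"
  assumes "independent B"
  shows "\<exists>x. \<forall>b\<in>B. x \<bullet> b = 1"
proof -
  obtain f :: "'a \<Rightarrow> real" where f: "linear f" "\<forall>b\<in>B. f b = 1"
    using linear_independent_extend[OF assms, of "\<lambda>_. 1::real"] by blast
  have "adjoint f 1 \<bullet> b = f b" for b
    using adjoint_works[OF f(1), of b 1] by (simp add: inner_commute)
  then show ?thesis
    using f(2) by (intro exI[of _ "adjoint f 1"]) simp
qed

text \<open>Diagonal terms vanish because \<open>c a\<close> cannot be positive and negative at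
  once; every other term is a nonnegative multiple of some
  \<open>a \<bullet> b \<le> 0\<close>.\<close>

lemma obtuse_parts:
  fixes A :: "'a::real_inner set"
  assumes "pairwise (\<lambda>a b. a \<bullet> b \<le> 0) A"
  shows "(\<Sum>a\<in>A. max 0 (c a) *\<^sub>R a) \<bullet> (\<Sum>a\<in>A. max 0 (- c a) *\<^sub>R a) \<le> 0"
proof -
  have "max 0 (c a) * (max 0 (- c b) * (a \<bullet> b)) \<le> 0" if "a \<in> A" "b \<in> A" for a b
  proof (cases "a = b")
    case True
    then show ?thesis by (auto simp: max_def)
  next
    case False
    then have "a \<bullet> b \<le> 0" using assms that by (auto simp: pairwise_def)
    then show ?thesis by (intro mult_nonneg_nonpos) auto
  qed
  then show ?thesis
    unfolding inner_sum_left inner_sum_right inner_scaleR_left inner_scaleR_right sum_distrib_left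
    by (intro sum_nonpos) (simp add: mult.left_commute)
qed

lemma sum_scaleR_parts:
  fixes A :: "'a::real_vector set"
  shows "(\<Sum>a\<in>A. c a *\<^sub>R a) = (\<Sum>a\<in>A. max 0 (c a) *\<^sub>R a) - (\<Sum>a\<in>A. max 0 (- c a) *\<^sub>R a)"
  unfolding sum_subtractf[symmetric]
  by (rule sum.cong) (auto simp: max_def simp flip: scaleR_diff_left)

text \<open>The two signed halves of a vanishing combination are the same vector, which has
  nonpositive square norm by \<open>obtuse_parts\<close> and so is 0. Pairing it with
  \<open>h\<close>, positive on all of \<open>A\<close>, then kills every coefficient.\<close>

lemma obtuse_independent:
  fixes A :: "'a::real_inner set"
  assumes "finite A" "pairwise (\<lambda>a b. a \<bullet> b \<le> 0) A" and h: "\<And>a. a \<in> A \<Longrightarrow> 0 < h \<bullet> a"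
  shows "independent A"
proof (rule independent_if_scalars_zero[OF assms(1)])
  fix c x assume 0: "(\<Sum>a\<in>A. c a *\<^sub>R a) = 0" and x: "x \<in> A"
  let ?P = "\<lambda>c. \<Sum>a\<in>A. max 0 (c a) *\<^sub>R a"
  have eq: "?P c = ?P (\<lambda>a. - c a)"
    using 0 sum_scaleR_parts[of c A] by simp
  then have "?P c \<bullet> ?P c \<le> 0"
    using obtuse_parts[OF assms(2), of c] by simp
  then have P0: "?P c = 0" by (metis inner_gt_zero_iff not_less)
  \<comment> \<open>Stated for every \<open>c\<close>, since it serves both the given coefficients
    and their negatives.\<close>
  have *: "c x \<le> 0" if "?P c = 0" for c :: "'a \<Rightarrow> real"
  proof -
    have "(\<Sum>a\<in>A. max 0 (c a) * (h \<bullet> a)) = h \<bullet> ?P c"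
      by (simp add: inner_sum_right)
    then have "(\<Sum>a\<in>A. max 0 (c a) * (h \<bullet> a)) = 0"
      using that by simp
    moreover have "0 \<le> max 0 (c a) * (h \<bullet> a)" if "a \<in> A" for a
      using h[OF that] by simp
    ultimately have "max 0 (c x) * (h \<bullet> x) = 0"
      using x assms(1) sum_nonneg_eq_0_iff[of A "\<lambda>a. max 0 (c a) * (h \<bullet> a)"] by blast
    then show ?thesis using h[OF x] by (auto simp: max_def split: if_splits)
  qed
  show "c x = 0"
    using *[of c] *[of "\<lambda>a. - c a"] P0 eq by simp
qed

text \<open>Within the span of an obtuse independent family, the dual cone lies in the cone itself:
  pairing the vector with its negative part gives
  \<open>?N \<bullet> ?N \<le> ?P \<bullet> ?N \<le> 0\<close>.\<close>

lemma obtuse_coeff_nonneg: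
  fixes A :: "'a::real_inner set"
  assumes "finite A" "pairwise (\<lambda>a b. a \<bullet> b \<le> 0) A" "independent A"
    and "\<And>a. a \<in> A \<Longrightarrow> 0 \<le> (\<Sum>b\<in>A. c b *\<^sub>R b) \<bullet> a" and "x \<in> A"
  shows "0 \<le> c x"
proof -
  let ?P = "\<Sum>a\<in>A. max 0 (c a) *\<^sub>R a" and ?N = "\<Sum>a\<in>A. max 0 (- c a) *\<^sub>R a"
  have "0 \<le> (\<Sum>b\<in>A. c b *\<^sub>R b) \<bullet> ?N"
    unfolding inner_sum_right inner_scaleR_right by (rule sum_nonneg) (use assms(4) in auto)
  then have "?N \<bullet> ?N \<le> ?P \<bullet> ?N"
    by (simp add: sum_scaleR_parts[of c A] inner_diff_left)
  also have "\<dots> \<le> 0" by (rule obtuse_parts[OF assms(2)])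
  finally have "?N = 0" by (metis inner_gt_zero_iff not_less)
  then have "max 0 (- c x) = 0"
    by (rule independentD[OF assms(3,1) subset_refl _ assms(5)])
  then show ?thesis by (simp add: max_def split: if_splits)
qed

lemma inner_sum_mset_nonpos:
  fixes M N :: "'a::real_inner multiset"
  assumes "\<And>x y. x \<in># M \<Longrightarrow> y \<in># N \<Longrightarrow> x \<bullet> y \<le> 0"
  shows "\<Sum>\<^sub># M \<bullet> \<Sum>\<^sub># N \<le> 0"
proof -
  have *: "x \<bullet> \<Sum>\<^sub># N \<le> 0" if "\<And>y. y \<in># N \<Longrightarrow> x \<bullet> y \<le> 0" for x and N :: "'a multiset"
    using that by (induction N) (auto simp: inner_add_right add_nonpos_nonpos)
  show ?thesis
    using assms by (induction M) (auto simp: inner_add_left intro!: add_nonpos_nonpos *)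
qed

section \<open>Rational dependence and clearing of denominators\<close>

lemma common_denominator:
  fixes q :: "'a \<Rightarrow> rat"
  assumes "finite F"
  shows "\<exists>d::nat. d > 0 \<and> (\<forall>x\<in>F. \<exists>k::int. of_nat d * q x = of_int k)"
  using assms
proof induction
  case empty
  show ?case by (intro exI[of _ 1]) auto
next
  case (insert y F)
  then obtain d :: nat where d: "d > 0" "\<And>x. x \<in> F \<Longrightarrow> \<exists>k::int. of_nat d * q x = of_int k" by blast
  obtain a b where ab: "quotient_of (q y) = (a, b)" by fastforce
  have b: "b > 0" and q: "q y = of_int a / of_int b"
    using quotient_of_denom_pos[OF ab] quotient_of_div[OF ab] by auto
  have nb: "(of_nat (nat b) :: rat) = of_int b" using b by simp
  show ?case
  proof (intro exI[of _ "nat b * d"] conjI ballI)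
    show "0 < nat b * d" using b d by simp
    fix x assume "x \<in> insert y F"
    then consider "x = y" | "x \<in> F" by blast
    then show "\<exists>k::int. of_nat (nat b * d) * q x = of_int k"
    proof cases
      case 1
      then have "of_nat (nat b * d) * q x = of_int (int d * a)"
        using b by (simp add: q nb)
      then show ?thesis by blast
    next
      case 2
      then obtain k :: int where "of_nat d * q x = of_int k" using d(2) by blast
      then have "of_nat (nat b * d) * q x = of_int (b * k)"
        by (simp add: nb mult.assoc)
      then show ?thesis by blast
    qed
  qed
qed

text \<open>Denominators can be cleared only from rational coefficients, so the dimension count is
  done over the rationals.\<close>

interpretation rat_span: vector_space "\<lambda>(q::rat) (v::'a::real_vector). (of_rat q :: real) *\<^sub>R v"
  by unfold_locales (auto simp: algebra_simps of_rat_add of_rat_mult)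

text \<open>\<open>\<Gamma>\<close> is independent over the rationals too and, like \<beta>, lies in
  the rational span of \<open>S\<close>. As that span has dimension at most \<open>card S\<close>,
  \<beta> is a rational combination of \<open>\<Gamma>\<close>.\<close>

lemma integer_multiple_in_lattice:
  fixes S \<Gamma> :: "'a::real_vector set"
  assumes "finite S" "independent \<Gamma>" "finite \<Gamma>" "card S \<le> card \<Gamma>"
    and int: "\<And>v. v \<in> insert \<beta> \<Gamma> \<Longrightarrow> \<exists>k::'a \<Rightarrow> int. v = (\<Sum>\<alpha>\<in>S. of_int (k \<alpha>) *\<^sub>R \<alpha>)"
  shows "\<exists>(d::nat) (z::'a \<Rightarrow> int). d > 0 \<and> real d *\<^sub>R \<beta> = (\<Sum>\<gamma>\<in>\<Gamma>. of_int (z \<gamma>) *\<^sub>R \<gamma>)"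
proof -
  have in_span: "v \<in> rat_span.span S" if v: "v \<in> insert \<beta> \<Gamma>" for v
  proof -
    obtain k :: "'a \<Rightarrow> int" where k: "v = (\<Sum>\<alpha>\<in>S. of_int (k \<alpha>) *\<^sub>R \<alpha>)" using int[OF v] by blast
    have "(\<Sum>\<alpha>\<in>S. (of_rat (of_int (k \<alpha>)) :: real) *\<^sub>R \<alpha>) \<in> rat_span.span S"
      by (intro rat_span.span_sum rat_span.span_scale rat_span.span_base)
    then show ?thesis by (simp add: k)
  qed
  have ind: "rat_span.independent \<Gamma>"
  proof (rule rat_span.independent_if_scalars_zero[OF assms(3)])
    fix q :: "'a \<Rightarrow> rat" and x
    assume "(\<Sum>x\<in>\<Gamma>. (of_rat (q x) :: real) *\<^sub>R x) = 0" "x \<in> \<Gamma>"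
    then have "(of_rat (q x) :: real) = 0"
      by (rule independentD[OF assms(2,3) subset_refl, where u = "\<lambda>x. of_rat (q x)"])
    then show "q x = 0" by simp
  qed
  have "\<beta> \<in> rat_span.span \<Gamma>"
  proof (rule ccontr)
    assume n: "\<beta> \<notin> rat_span.span \<Gamma>"
    then have "rat_span.independent (insert \<beta> \<Gamma>)"
      using ind by (simp add: rat_span.independent_insert)
    then have "card (insert \<beta> \<Gamma>) \<le> card S"
      using rat_span.independent_span_bound[OF assms(1)] in_span by blast
    moreover have "\<beta> \<notin> \<Gamma>" using n rat_span.span_base by blast
    ultimately show False using assms(3,4) by simp
  qed
  then obtain q where q: "\<beta> = (\<Sum>\<gamma>\<in>\<Gamma>. (of_rat (q \<gamma>) :: real) *\<^sub>R \<gamma>)"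
    unfolding rat_span.span_finite[OF assms(3)] by (rule rangeE)
  obtain d :: nat where d: "d > 0" "\<And>x. x \<in> \<Gamma> \<Longrightarrow> \<exists>k::int. of_nat d * q x = of_int k"
    using common_denominator[OF assms(3), of q] by auto
  then obtain z where z: "\<And>x. x \<in> \<Gamma> \<Longrightarrow> of_nat d * q x = of_int (z x)" by metis
  have "real d * of_rat (q x) = of_int (z x)" if "x \<in> \<Gamma>" for x
  proof -
    have "real d * of_rat (q x) = (of_rat (of_nat d * q x) :: real)" by (simp add: of_rat_mult)
    then show ?thesis using z[OF that] by simp
  qed
  then have "real d *\<^sub>R \<beta> = (\<Sum>\<gamma>\<in>\<Gamma>. of_int (z \<gamma>) *\<^sub>R \<gamma>)"
    unfolding q scaleR_sum_right by (intro sum.cong) auto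
  with d(1) show ?thesis by blast
qed

section \<open>The cone \<open>Q_plus\<close>\<close>

lemma Q_plus_0: "0 \<in> Q_plus S"
  unfolding Q_plus_def by (intro range_eqI[of _ _ "\<lambda>_. 0"]) simp

lemma Q_plus_add: "x \<in> Q_plus S \<Longrightarrow> y \<in> Q_plus S \<Longrightarrow> x + y \<in> Q_plus S"
proof -
  assume "x \<in> Q_plus S" "y \<in> Q_plus S"
  then obtain m n where "x = (\<Sum>\<alpha>\<in>S. real (m \<alpha>) *\<^sub>R \<alpha>)" "y = (\<Sum>\<alpha>\<in>S. real (n \<alpha>) *\<^sub>R \<alpha>)"
    by (auto simp: Q_plus_def)
  then have "x + y = (\<Sum>\<alpha>\<in>S. real (m \<alpha> + n \<alpha>) *\<^sub>R \<alpha>)"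
    by (simp add: scaleR_add_left sum.distrib)
  then show ?thesis unfolding Q_plus_def by (rule range_eqI[where x = "\<lambda>\<alpha>. m \<alpha> + n \<alpha>"])
qed

section \<open>Root systems with a chosen base\<close>

locale root_basis =
  fixes \<Delta> S :: "'a::euclidean_space set"
  assumes root_system: "root_system \<Delta>" and reduced: "reduced \<Delta>"
    and crystallographic: "crystallographic \<Delta>" and simple: "simple_roots \<Delta> S"
begin

abbreviation "pos \<equiv> positive_roots \<Delta> S"

text \<open>Inner product with this vector is the height, that is, the sum of the coordinates with
  respect to the basis \<open>S\<close>.\<close>

definition height_vec :: 'a where
  "height_vec = (SOME x. \<forall>\<alpha>\<in>S. x \<bullet> \<alpha> = 1)"

lemma simple_basis: "S \<subseteq> \<Delta>" "independent S" "finite S" "span S = UNIV"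
  using simple root_system independent_imp_finite
  by (auto simp: simple_roots_def root_system_def)

lemma finite_roots: "finite \<Delta>" and root_nonzero: "\<alpha> \<in> \<Delta> \<Longrightarrow> \<alpha> \<noteq> 0"
  using root_system by (auto simp: root_system_def)

lemma card_S: "card S = DIM('a)"
  using dim_eq_card_independent[OF simple_basis(2)] simple_basis(4) by (metis dim_UNIV dim_span)

lemma reflect: "\<alpha> \<in> \<Delta> \<Longrightarrow> \<beta> \<in> \<Delta> \<Longrightarrow> \<beta> - (2 * (\<beta> \<bullet> \<alpha>) / (\<alpha> \<bullet> \<alpha>)) *\<^sub>R \<alpha> \<in> \<Delta>"
  using root_system by (auto simp: root_system_def root_reflection_def)

lemma Cartan_integer: "\<alpha> \<in> \<Delta> \<Longrightarrow> \<beta> \<in> \<Delta> \<Longrightarrow> 2 * (\<beta> \<bullet> \<alpha>) / (\<alpha> \<bullet> \<alpha>) \<in> \<int>"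
  using crystallographic by (auto simp: crystallographic_def)

lemma uminus_root: "\<alpha> \<in> \<Delta> \<Longrightarrow> - \<alpha> \<in> \<Delta>"
  using reflect[of \<alpha> \<alpha>] root_nonzero[of \<alpha>] by (simp add: scaleR_2)

lemma height_S: "\<alpha> \<in> S \<Longrightarrow> height_vec \<bullet> \<alpha> = 1"
  using someI_ex[OF ex_inner_eq_1[OF simple_basis(2)]] unfolding height_vec_def by blast

lemma height_sum: "height_vec \<bullet> (\<Sum>\<alpha>\<in>S. real (n \<alpha>) *\<^sub>R \<alpha>) = (\<Sum>\<alpha>\<in>S. real (n \<alpha>))"
  by (simp add: inner_sum_right height_S)

lemma height_nonneg: "v \<in> Q_plus S \<Longrightarrow> 0 \<le> height_vec \<bullet> v"
  by (auto simp: Q_plus_def height_sum intro!: sum_nonneg)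

lemma height_eq_0: "v \<in> Q_plus S \<Longrightarrow> height_vec \<bullet> v = 0 \<Longrightarrow> v = 0"
  by (auto simp: Q_plus_def height_sum simple_basis(3) sum_nonneg_eq_0_iff)

lemma height_ge_1: assumes "v \<in> Q_plus S" "v \<noteq> 0" shows "1 \<le> height_vec \<bullet> v"
proof -
  obtain n where n: "v = (\<Sum>\<alpha>\<in>S. real (n \<alpha>) *\<^sub>R \<alpha>)" using assms(1) by (auto simp: Q_plus_def)
  have "height_vec \<bullet> v = real (\<Sum>\<alpha>\<in>S. n \<alpha>)" unfolding n height_sum by simp
  moreover have "height_vec \<bullet> v \<noteq> 0" using height_eq_0 assms by blast
  ultimately show ?thesis by (simp del: of_nat_sum)
qed

lemma height_pos: "\<beta> \<in> pos \<Longrightarrow> 1 \<le> height_vec \<bullet> \<beta>"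
  using height_ge_1 root_nonzero by (auto simp: positive_roots_def)

lemma Q_plus_antisym: "v \<in> Q_plus S \<Longrightarrow> - v \<in> Q_plus S \<Longrightarrow> v = 0"
  using height_nonneg[of v] height_nonneg[of "- v"] height_eq_0[of v] by (simp add: inner_minus_right)

lemma Q_plus_minus_simple:
  assumes "v \<in> Q_plus S" "v \<noteq> 0"
  shows "\<exists>\<alpha>\<in>S. v - \<alpha> \<in> Q_plus S"
proof -
  obtain n where n: "v = (\<Sum>\<alpha>\<in>S. real (n \<alpha>) *\<^sub>R \<alpha>)" using assms(1) by (auto simp: Q_plus_def)
  obtain \<alpha> where a: "\<alpha> \<in> S" "n \<alpha> \<noteq> 0"
    using assms(2) unfolding n by (metis (no_types, lifting) of_nat_0 scale_zero_left sum.neutral)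
  have "v - \<alpha> = (\<Sum>x\<in>S. real ((n(\<alpha> := n \<alpha> - 1)) x) *\<^sub>R x)"
    unfolding n sum.remove[OF simple_basis(3) a(1)] using a(2)
    by (simp add: of_nat_diff scaleR_diff_left algebra_simps)
  then have "v - \<alpha> \<in> Q_plus S" unfolding Q_plus_def by blast
  then show ?thesis using a(1) by blast
qed

lemma root_cases: "\<beta> \<in> \<Delta> \<Longrightarrow> \<beta> \<in> pos \<or> - \<beta> \<in> pos"
  using simple uminus_root by (auto simp: simple_roots_def positive_roots_def)

lemma simple_pos: assumes "\<alpha> \<in> S" shows "\<alpha> \<in> pos"
proof -
  have "\<alpha> \<in> Q_plus S"
    unfolding Q_plus_def
    using assms simple_basis(3)
    by (intro range_eqI[of _ _ "\<lambda>x. if x = \<alpha> then 1 else 0"])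
       (simp add: if_distrib[of real] if_distrib[of "\<lambda>x. x *\<^sub>R _"] cong: if_cong)
  then show ?thesis using assms simple_basis(1) by (auto simp: positive_roots_def)
qed

lemma Cartan_integers_ge_1:
  assumes "\<alpha> \<in> \<Delta>" "\<beta> \<in> \<Delta>" "0 < \<beta> \<bullet> \<alpha>"
  shows "1 \<le> 2 * (\<beta> \<bullet> \<alpha>) / (\<alpha> \<bullet> \<alpha>)"
proof -
  have "0 < 2 * (\<beta> \<bullet> \<alpha>) / (\<alpha> \<bullet> \<alpha>)" using assms root_nonzero by simp
  moreover obtain k :: int where "2 * (\<beta> \<bullet> \<alpha>) / (\<alpha> \<bullet> \<alpha>) = of_int k"
    using Cartan_integer[OF assms(1,2)] by (auto elim: Ints_cases)
  ultimately show ?thesis by simp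
qed

text \<open>If one of the two Cartan integers is 1, a reflection produces the difference up to sign.
  Otherwise both are at least 2, which forces equality in Cauchy-Schwarz, and parallel roots with
  positive inner product coincide in a reduced system.\<close>

lemma diff_root:
  assumes ab: "\<alpha> \<in> \<Delta>" "\<beta> \<in> \<Delta>" and p: "0 < \<alpha> \<bullet> \<beta>" and "\<alpha> \<noteq> \<beta>"
  shows "\<alpha> - \<beta> \<in> \<Delta>"
proof -
  define a b where "a = 2 * (\<alpha> \<bullet> \<beta>) / (\<beta> \<bullet> \<beta>)" and "b = 2 * (\<beta> \<bullet> \<alpha>) / (\<alpha> \<bullet> \<alpha>)"
  have "a \<in> \<int>" "b \<in> \<int>" unfolding a_def b_def using Cartan_integer ab by auto
  have a1: "a \<ge> 1" and b1: "b \<ge> 1"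
    using Cartan_integers_ge_1[of \<beta> \<alpha>] Cartan_integers_ge_1[of \<alpha> \<beta>] ab p
    by (auto simp: a_def b_def inner_commute[of \<beta> \<alpha>])
  have n: "0 < \<alpha> \<bullet> \<alpha>" "0 < \<beta> \<bullet> \<beta>" using root_nonzero ab by auto
  consider "a = 1" | "b = 1" | "a \<ge> 2" "b \<ge> 2"
  proof -
    obtain k l :: int where "a = of_int k" "b = of_int l"
      using \<open>a \<in> \<int>\<close> \<open>b \<in> \<int>\<close> by (auto elim!: Ints_cases)
    then have "a = 1 \<or> b = 1 \<or> (a \<ge> 2 \<and> b \<ge> 2)" using a1 b1 by auto
    then show ?thesis using that by blast
  qed
  then show ?thesis
  proof cases
    case 1
    then show ?thesis using reflect[OF ab(2,1)] by (simp only: a_def scaleR_one)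
  next
    case 2
    then have "\<beta> - \<alpha> \<in> \<Delta>" using reflect[OF ab] by (simp only: b_def scaleR_one)
    then show ?thesis using uminus_root by force
  next
    case 3
    \<comment> \<open>The product of the two Cartan integers is four times the squared cosine of the
      angle.\<close>
    have "4 \<le> a * b" using mult_mono[OF 3] 3(1) by simp
    then have "(\<alpha> \<bullet> \<alpha>) * (\<beta> \<bullet> \<beta>) \<le> (\<alpha> \<bullet> \<beta>)\<^sup>2"
      using n by (simp add: a_def b_def field_simps power2_eq_square inner_commute)
    then have "(\<alpha> \<bullet> \<beta>)\<^sup>2 = (\<alpha> \<bullet> \<alpha>) * (\<beta> \<bullet> \<beta>)"
      using Cauchy_Schwarz_ineq[of \<alpha> \<beta>] by simp
    \<comment> \<open>Up to a factor, \<open>w\<close> is the component of \<alpha> orthogonal to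
      \<beta>.\<close>
    moreover define w where "w = (\<beta> \<bullet> \<beta>) *\<^sub>R \<alpha> - (\<alpha> \<bullet> \<beta>) *\<^sub>R \<beta>"
    ultimately have "w \<bullet> w = 0"
      by (simp add: w_def inner_diff_left inner_diff_right inner_commute power2_eq_square algebra_simps)
    then have par: "(\<beta> \<bullet> \<beta>) *\<^sub>R \<alpha> = (\<alpha> \<bullet> \<beta>) *\<^sub>R \<beta>" by (simp add: w_def)
    have "\<alpha> = inverse (\<beta> \<bullet> \<beta>) *\<^sub>R ((\<beta> \<bullet> \<beta>) *\<^sub>R \<alpha>)" using n by simp
    then have eq: "\<alpha> = ((\<alpha> \<bullet> \<beta>) / (\<beta> \<bullet> \<beta>)) *\<^sub>R \<beta>"
      unfolding par by (simp add: divide_inverse_commute)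
    have "(\<alpha> \<bullet> \<beta>) / (\<beta> \<bullet> \<beta>) > 0" using n p by simp
    moreover have "(\<alpha> \<bullet> \<beta>) / (\<beta> \<bullet> \<beta>) = 1 \<or> (\<alpha> \<bullet> \<beta>) / (\<beta> \<bullet> \<beta>) = -1"
      using reduced eq ab unfolding reduced_def by metis
    ultimately have "(\<alpha> \<bullet> \<beta>) / (\<beta> \<bullet> \<beta>) = 1" by linarith
    with eq have "\<alpha> = \<beta>" by simp
    then show ?thesis using \<open>\<alpha> \<noteq> \<beta>\<close> by simp
  qed
qed

lemma diff_root_cases:
  assumes "\<alpha> \<in> pos" "\<beta> \<in> pos" "0 < \<alpha> \<bullet> \<beta>"
  shows "\<alpha> = \<beta> \<or> \<alpha> - \<beta> \<in> pos \<or> \<beta> - \<alpha> \<in> pos"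
  using diff_root[of \<alpha> \<beta>] root_cases[of "\<alpha> - \<beta>"] assms by (auto simp: positive_roots_def)

text \<open>A difference of simple roots has height 0, whereas a positive root has height at least
  1; an acute angle would make the difference a root.\<close>

lemma simple_obtuse:
  assumes "\<alpha> \<in> S" "\<beta> \<in> S" "\<alpha> \<noteq> \<beta>"
  shows "\<alpha> - \<beta> \<notin> \<Delta>" "\<alpha> \<bullet> \<beta> \<le> 0"
proof -
  have *: "\<alpha> - \<beta> \<notin> pos" if "\<alpha> \<in> S" "\<beta> \<in> S" for \<alpha> \<beta>
    using height_pos[of "\<alpha> - \<beta>"] that by (auto simp: inner_diff_right height_S)
  show 1: "\<alpha> - \<beta> \<notin> \<Delta>" using *[of \<alpha> \<beta>] *[of \<beta> \<alpha>] assms root_cases[of "\<alpha> - \<beta>"] by auto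
  show "\<alpha> \<bullet> \<beta> \<le> 0" using diff_root[of \<alpha> \<beta>] 1 assms simple_basis(1) by fastforce
qed

text \<open>The angle bound behind the final edge count. If \<alpha> and \<beta> were orthogonal,
  reflecting their sum in \<alpha> would give the root \<beta> - \<alpha>. So both Cartan integers
  are at most -1, and multiplying the two resulting bounds yields the cosine estimate.\<close>

lemma simple_sum_inner:
  assumes "\<alpha> \<in> S" "\<beta> \<in> S" "\<alpha> \<noteq> \<beta>" "\<alpha> + \<beta> \<in> \<Delta>"
  shows "(\<alpha> /\<^sub>R norm \<alpha>) \<bullet> (\<beta> /\<^sub>R norm \<beta>) \<le> - (1 / 2)"
proof -
  have mem: "\<alpha> \<in> \<Delta>" "\<beta> \<in> \<Delta>" using assms simple_basis(1) by auto
  have n: "0 < norm \<alpha>" "0 < norm \<beta>" "\<alpha> \<bullet> \<alpha> \<noteq> 0" using root_nonzero mem by auto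
  have "\<alpha> \<bullet> \<beta> \<noteq> 0"
  proof
    assume 0: "\<alpha> \<bullet> \<beta> = 0"
    have "2 * ((\<alpha> + \<beta>) \<bullet> \<alpha>) / (\<alpha> \<bullet> \<alpha>) = 2"
      using n 0 by (simp add: inner_add_left inner_commute[of \<beta> \<alpha>])
    then have "(\<alpha> + \<beta>) - 2 *\<^sub>R \<alpha> \<in> \<Delta>" using reflect[OF mem(1) assms(4)] by metis
    then show False using simple_obtuse(1)[of \<beta> \<alpha>] assms by (simp add: scaleR_2)
  qed
  then have neg: "\<alpha> \<bullet> \<beta> < 0" using simple_obtuse(2)[OF assms(1-3)] by simp
  then have "1 \<le> 2 * ((- \<beta>) \<bullet> \<alpha>) / (\<alpha> \<bullet> \<alpha>)" "1 \<le> 2 * ((- \<alpha>) \<bullet> \<beta>) / (\<beta> \<bullet> \<beta>)"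
    using mem uminus_root Cartan_integers_ge_1[of \<alpha> "- \<beta>"] Cartan_integers_ge_1[of \<beta> "- \<alpha>"]
    by (auto simp: inner_commute)
  then have "(norm \<alpha>)\<^sup>2 \<le> 2 * - (\<alpha> \<bullet> \<beta>)" "(norm \<beta>)\<^sup>2 \<le> 2 * - (\<alpha> \<bullet> \<beta>)"
    using n root_nonzero mem by (auto simp: field_simps inner_commute power2_norm_eq_inner)
  then have "(norm \<alpha>)\<^sup>2 * (norm \<beta>)\<^sup>2 \<le> (2 * - (\<alpha> \<bullet> \<beta>)) * (2 * - (\<alpha> \<bullet> \<beta>))"
    using neg by (intro mult_mono) auto
  then have "(norm \<alpha> * norm \<beta>)\<^sup>2 \<le> (2 * - (\<alpha> \<bullet> \<beta>))\<^sup>2"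
    by (simp add: power2_eq_square algebra_simps)
  then have "norm \<alpha> * norm \<beta> \<le> 2 * - (\<alpha> \<bullet> \<beta>)"
    by (rule power2_le_imp_le) (use neg in simp)
  then show ?thesis using n by (simp add: field_simps)
qed

lemma root_integer_combination:
  assumes "\<beta> \<in> pos"
  shows "\<exists>k::'a \<Rightarrow> int. \<beta> = (\<Sum>\<alpha>\<in>S. of_int (k \<alpha>) *\<^sub>R \<alpha>)"
proof -
  obtain n where "\<beta> = (\<Sum>\<alpha>\<in>S. real (n \<alpha>) *\<^sub>R \<alpha>)"
    using assms by (auto simp: positive_roots_def Q_plus_def)
  then show ?thesis by (intro exI[of _ "\<lambda>a. int (n a)"]) simp
qed

end


section \<open>Antichains and the low roots\<close>

locale antichain = root_basis +
  fixes \<Gamma> :: "'a set"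
  assumes antichain: "root_antichain \<Delta> S \<Gamma>"
begin

text \<open>The complement of this set in \<open>pos\<close> is the upper ideal generated by
  \<open>\<Gamma>\<close>.\<close>

definition below :: "'a set" where
  "below = {\<beta> \<in> pos. \<forall>\<gamma>\<in>\<Gamma>. \<beta> - \<gamma> \<notin> Q_plus S}"

lemma antichain_pos: "\<gamma> \<in> \<Gamma> \<Longrightarrow> \<gamma> \<in> pos"
  using antichain by (auto simp: root_antichain_def)

lemma antichain_diff: "\<gamma> \<in> \<Gamma> \<Longrightarrow> \<gamma>' \<in> \<Gamma> \<Longrightarrow> \<gamma> - \<gamma>' \<in> Q_plus S \<Longrightarrow> \<gamma> = \<gamma>'"
  using antichain by (auto simp: root_antichain_def pairwise_def root_le_def)

lemma finite_antichain: "finite \<Gamma>"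
  using finite_roots antichain_pos by (auto simp: positive_roots_def intro: finite_subset)

lemma antichain_obtuse: "pairwise (\<lambda>a b. a \<bullet> b \<le> 0) \<Gamma>"
proof (rule pairwiseI)
  fix a b assume ab: "a \<in> \<Gamma>" "b \<in> \<Gamma>" "a \<noteq> b"
  show "a \<bullet> b \<le> 0"
  proof (rule ccontr)
    assume "\<not> a \<bullet> b \<le> 0"
    then have "a - b \<in> pos \<or> b - a \<in> pos"
      using diff_root_cases[of a b] antichain_pos ab by auto
    then show False using antichain_diff[of a b] antichain_diff[of b a] ab
      by (auto simp: positive_roots_def)
  qed
qed

lemma antichain_independent: "independent \<Gamma>"
  using height_pos antichain_pos
  by (intro obtuse_independent[OF finite_antichain antichain_obtuse, of height_vec]) force

lemma below_minus:
  assumes "\<beta> \<in> below" "\<beta> - \<delta> \<in> Q_plus S" "\<delta> \<in> pos"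
  shows "\<delta> \<in> below"
proof -
  have "\<delta> - \<gamma> \<notin> Q_plus S" if "\<gamma> \<in> \<Gamma>" for \<gamma>
    using Q_plus_add[OF assms(2), of "\<delta> - \<gamma>"] assms(1) that by (auto simp: below_def)
  then show ?thesis using assms(3) by (auto simp: below_def)
qed

text \<open>An element of \<open>\<Gamma>\<close> below \<delta> would lie below \<gamma> and so
  equal \<gamma>; antisymmetry would then make \<open>\<gamma> - \<delta>\<close> zero.\<close>

lemma antichain_minus_below:
  assumes "\<gamma> \<in> \<Gamma>" "\<gamma> - \<delta> \<in> pos" "\<delta> \<in> pos"
  shows "\<delta> \<in> below"
proof -
  have g: "\<gamma> - \<delta> \<in> Q_plus S" "\<gamma> - \<delta> \<noteq> 0"
    using assms(2) root_nonzero[of "\<gamma> - \<delta>"] by (auto simp: positive_roots_def)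
  have "\<delta> - \<gamma>' \<notin> Q_plus S" if "\<gamma>' \<in> \<Gamma>" for \<gamma>'
  proof
    assume d: "\<delta> - \<gamma>' \<in> Q_plus S"
    then have "\<gamma> = \<gamma>'"
      using Q_plus_add[OF g(1) d] antichain_diff[OF assms(1) that] by simp
    then show False using Q_plus_antisym[of "\<gamma> - \<delta>"] g d by simp
  qed
  then show ?thesis using assms(3) by (auto simp: below_def)
qed

lemma not_below_up:
  assumes "\<alpha> \<in> pos - below" "\<beta> - \<alpha> \<in> Q_plus S"
  shows "\<beta> \<notin> below"
  using below_minus[of \<beta> \<alpha>] assms by auto

text \<open>An element of \<open>\<Gamma>\<close> below \<alpha> has height at least 1, which is
  already the height of \<alpha>, so the difference has height 0.\<close>

lemma simple_not_below:
  assumes "\<alpha> \<in> S" "\<alpha> \<notin> below"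
  shows "\<alpha> \<in> \<Gamma>"
proof -
  obtain \<gamma> where g: "\<gamma> \<in> \<Gamma>" "\<alpha> - \<gamma> \<in> Q_plus S"
    using simple_pos assms by (auto simp: below_def)
  then have "\<alpha> = \<gamma>"
    using height_pos[OF antichain_pos[OF g(1)]] height_S[OF assms(1)]
      height_nonneg[OF g(2)] height_eq_0[OF g(2)] by (simp add: inner_diff_right)
  then show ?thesis using g by simp
qed

text \<open>Excludes one sign when an upper root is cancelled against a root in
  \<open>below \<union> \<Gamma>\<close>: if \<gamma> is in \<open>\<Gamma>\<close>, then \<alpha>
  would be low, and a low \<gamma> cannot dominate an upper root.\<close>

lemma minus_upper_notin:
  assumes "\<alpha> \<in> pos - below" "\<gamma> \<in> below \<union> \<Gamma>" "\<gamma> - \<alpha> \<in> pos"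
  shows False
  using assms antichain_minus_below[of \<gamma> \<alpha>] not_below_up[of \<alpha> \<gamma>]
  by (auto simp: positive_roots_def)

text \<open>By induction on the number of summands: a pair of summands on opposite sides with positive
  inner product differs by a root, which replaces the pair. If there is no such pair, then the common
  value of the two sides has nonpositive square norm.\<close>

lemma sum_comparison:
  assumes "set_mset A \<subseteq> pos - below" "set_mset B \<subseteq> pos" "set_mset C \<subseteq> below \<union> \<Gamma>"
    and "\<Sum>\<^sub># A + \<Sum>\<^sub># B = \<Sum>\<^sub># C" and "size C \<le> size A"
  shows "B = {#} \<and> A = C"
  using assms
proof (induction "size A + size B + size C" arbitrary: A B C rule: less_induct)
  case less
  have Cpos: "set_mset C \<subseteq> pos" using less.prems(3) antichain_pos by (auto simp: below_def)
  consider a c where "a \<in># A" "c \<in># C" "0 < a \<bullet> c"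
    | b c where "b \<in># B" "c \<in># C" "0 < b \<bullet> c"
    | "\<And>x c. x \<in># A + B \<Longrightarrow> c \<in># C \<Longrightarrow> x \<bullet> c \<le> 0"
    by (metis not_le union_iff)
  then show ?case
  proof cases
    case (1 a c)
    obtain A' C' where A': "A = add_mset a A'" and C': "C = add_mset c C'"
      using 1 by (meson mset_add)
    have "a = c \<or> a - c \<in> pos \<or> c - a \<in> pos"
      using 1 less.prems(1) Cpos by (intro diff_root_cases) auto
    moreover have "c - a \<notin> pos"
      using minus_upper_notin[of a c] 1 less.prems(1,3) by auto
    ultimately consider "a = c" | "a - c \<in> pos" by blast
    then show ?thesis
    proof cases
      case 1
      then have "B = {#} \<and> A' = C'"
        using less.prems unfolding A' C' by (intro less.hyps) (auto simp: A' C')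
      then show ?thesis by (simp add: A' C' 1)
    next
      case 2
      \<comment> \<open>Both \<open>A\<close> and \<open>C\<close> lose one element, so the size
        condition survives; the induction hypothesis would make a nonempty multiset empty, so this
        case is impossible.\<close>
      then have "add_mset (a - c) B = {#} \<and> A' = C'"
        using less.prems unfolding A' C' by (intro less.hyps) (auto simp: A' C' algebra_simps)
      then show ?thesis by simp
    qed
  next
    case (2 b c)
    obtain B' C' where B': "B = add_mset b B'" and C': "C = add_mset c C'"
      using 2 by (meson mset_add)
    have "b = c \<or> b - c \<in> pos \<or> c - b \<in> pos"
      using 2 less.prems(2) Cpos by (intro diff_root_cases) auto
    then consider "b = c" | "b - c \<in> pos" | "c - b \<in> pos" by blast
    then show ?thesis
    proof cases
      case 1
      \<comment> \<open>\<open>C\<close> shrinks while \<open>A\<close> does not, hence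
        \<open>A = C'\<close> contradicts \<open>size C \<le> size A\<close>.\<close>
      then have "B' = {#} \<and> A = C'"
        using less.prems unfolding B' C' by (intro less.hyps) (auto simp: B' C')
      then show ?thesis using less.prems(5) by (simp add: C')
    next
      case 2
      then have "add_mset (b - c) B' = {#} \<and> A = C'"
        using less.prems unfolding B' C' by (intro less.hyps) (auto simp: B' C' algebra_simps)
      then show ?thesis by simp
    next
      case 3
      have b: "b \<in> pos" using less.prems(2) B' by auto
      \<comment> \<open>The replacement for \<open>c\<close> must be low for the induction
        hypothesis to apply; that low root would then occur in \<open>A\<close>, which contains
        none.\<close>
      have "c - b \<in> below"
        using 3 less.prems(3) b antichain_minus_below[of c "c - b"] below_minus[of c "c - b"]
        by (auto simp: C' positive_roots_def)
      moreover from this have "B' = {#} \<and> A = add_mset (c - b) C'"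
        using less.prems unfolding B' C' by (intro less.hyps) (auto simp: B' C' algebra_simps)
      ultimately show ?thesis using less.prems(1) by auto
    qed
  next
    case 3
    have "(\<Sum>\<^sub># A + \<Sum>\<^sub># B) \<bullet> \<Sum>\<^sub># C \<le> 0"
      using inner_sum_mset_nonpos[of "A + B" C] 3 by simp
    then have 0: "\<Sum>\<^sub># (A + B) = 0" "\<Sum>\<^sub># C = 0"
      using less.prems(4) by (auto simp: order.antisym[OF _ inner_ge_zero] simp flip: inner_eq_zero_iff)
    \<comment> \<open>Heights of positive roots are at least 1, so a sum of positive roots is zero
      only if it is empty.\<close>
    have *: "real (size M) \<le> height_vec \<bullet> \<Sum>\<^sub># M" if "set_mset M \<subseteq> pos" for M
      using that by (induction M) (auto simp: inner_add_right dest!: height_pos)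
    have "set_mset (A + B) \<subseteq> pos" using less.prems(1,2) by auto
    from *[OF this] *[OF Cpos] have "size (A + B) \<le> 0" "size C \<le> 0"
      unfolding 0 inner_zero_right of_nat_le_0_iff by simp_all
    then show ?thesis by simp
  qed
qed

end

section \<open>Antichains of maximal size and the vector \<open>x0\<close>\<close>

locale full_antichain = antichain +
  assumes card_antichain: "card \<Gamma> = card S"
begin

definition x0 :: 'a where
  "x0 = (SOME x. \<forall>\<gamma>\<in>\<Gamma>. x \<bullet> \<gamma> = 1)"

lemma x0_antichain: "\<gamma> \<in> \<Gamma> \<Longrightarrow> x0 \<bullet> \<gamma> = 1"
  using someI_ex[OF ex_inner_eq_1[OF antichain_independent]] unfolding x0_def by blast

lemma span_antichain: "span \<Gamma> = UNIV"
  using card_eq_dim[of \<Gamma> UNIV] antichain_independent finite_antichain card_antichain card_S by auto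

text \<open>Otherwise write \<open>d\<close> times \<beta> as an integral combination of
  \<open>\<Gamma>\<close> and separate the signs: \<open>A\<close> has the same sum as
  \<open>N\<close> together with \<open>d\<close> copies of \<beta>. As \<open>x0\<close> is 1 on
  \<open>\<Gamma>\<close>, it counts elements, so \<open>size A - size N\<close> is at least
  \<open>d\<close>. Then \<open>sum_comparison\<close> makes the two sides equal as multisets,
  putting the low root \<beta> into \<open>\<Gamma>\<close>.\<close>

lemma x0_below_less_1:
  assumes b: "\<beta> \<in> below"
  shows "x0 \<bullet> \<beta> < 1"
proof (rule ccontr)
  assume ge: "\<not> x0 \<bullet> \<beta> < 1"
  have pos: "\<beta> \<in> pos" using b by (simp add: below_def)
  obtain d :: nat and z :: "'a \<Rightarrow> int" where d: "d > 0"
    and z: "real d *\<^sub>R \<beta> = (\<Sum>\<gamma>\<in>\<Gamma>. of_int (z \<gamma>) *\<^sub>R \<gamma>)"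
  proof -
    have "v \<in> pos" if "v \<in> insert \<beta> \<Gamma>" for v using that pos antichain_pos by auto
    then show ?thesis
      using that integer_multiple_in_lattice[OF simple_basis(3) antichain_independent finite_antichain
        eq_refl[OF card_antichain[symmetric]], of \<beta>] root_integer_combination by meson
  qed
  define A where "A = (\<Sum>\<gamma>\<in>\<Gamma>. replicate_mset (nat (z \<gamma>)) \<gamma>)"
  define N where "N = (\<Sum>\<gamma>\<in>\<Gamma>. replicate_mset (nat (- z \<gamma>)) \<gamma>)"
  have sums: "\<Sum>\<^sub># (\<Sum>\<gamma>\<in>F. replicate_mset (k \<gamma>) \<gamma>) = (\<Sum>\<gamma>\<in>F. real (k \<gamma>) *\<^sub>R \<gamma>)"
    and sizes: "size (\<Sum>\<gamma>\<in>F. replicate_mset (k \<gamma>) \<gamma>) = (\<Sum>\<gamma>\<in>F. k \<gamma>)"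
    and sets: "set_mset (\<Sum>\<gamma>\<in>F. replicate_mset (k \<gamma>) \<gamma>) \<subseteq> F"
    if "finite F" for k and F :: "'a set"
    using that
  proof (induction F)
    case (insert x F)
    have "\<Sum>\<^sub># (replicate_mset n x) = real n *\<^sub>R x" for n
      by (induction n) (auto simp: algebra_simps)
    with insert show "\<Sum>\<^sub># (\<Sum>\<gamma>\<in>insert x F. replicate_mset (k \<gamma>) \<gamma>) = (\<Sum>\<gamma>\<in>insert x F. real (k \<gamma>) *\<^sub>R \<gamma>)"
      and "size (\<Sum>\<gamma>\<in>insert x F. replicate_mset (k \<gamma>) \<gamma>) = (\<Sum>\<gamma>\<in>insert x F. k \<gamma>)"
      and "set_mset (\<Sum>\<gamma>\<in>insert x F. replicate_mset (k \<gamma>) \<gamma>) \<subseteq> insert x F" by auto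
  qed auto
  have \<Gamma>: "\<Gamma> \<subseteq> pos - below"
  proof
    fix \<gamma> assume "\<gamma> \<in> \<Gamma>"
    then show "\<gamma> \<in> pos - below"
      using antichain_pos Q_plus_0[of S] by (auto simp: below_def intro!: bexI[of _ \<gamma>])
  qed
  have int_parts: "real_of_int i = real (nat i) - real (nat (- i))" for i by simp
  \<comment> \<open>The multiset in the place of \<open>B\<close> is empty; only the equality of the
    other two is wanted.\<close>
  have "replicate_mset 0 \<beta> = {#} \<and> A = replicate_mset d \<beta> + N"
  proof (rule sum_comparison)
    have "\<Sum>\<^sub># A - \<Sum>\<^sub># N = real d *\<^sub>R \<beta>"
      unfolding A_def N_def sums[OF finite_antichain] z int_parts
      by (simp add: scaleR_diff_left sum_subtractf)
    then show "\<Sum>\<^sub># A + \<Sum>\<^sub># (replicate_mset 0 \<beta>) = \<Sum>\<^sub># (replicate_mset d \<beta> + N)"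
      using sums[of "{\<beta>}" "\<lambda>_. d"] by (simp add: algebra_simps)
    have "real d \<le> real d * (x0 \<bullet> \<beta>)" using ge d by simp
    also have "\<dots> = x0 \<bullet> (real d *\<^sub>R \<beta>)" by simp
    also have "\<dots> = (\<Sum>\<gamma>\<in>\<Gamma>. of_int (z \<gamma>))"
      unfolding z by (simp add: inner_sum_right x0_antichain)
    also have "\<dots> = real (size A) - real (size N)"
      unfolding int_parts by (simp add: A_def N_def sizes finite_antichain sum_subtractf)
    finally show "size (replicate_mset d \<beta> + N) \<le> size A" by simp
    show "set_mset A \<subseteq> pos - below"
      using \<Gamma> sets[OF finite_antichain, of "\<lambda>\<gamma>. nat (z \<gamma>)"] unfolding A_def by (rule order_trans[rotated])
    show "set_mset (replicate_mset d \<beta> + N) \<subseteq> below \<union> \<Gamma>"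
      using b sets[OF finite_antichain, of "\<lambda>\<gamma>. nat (- z \<gamma>)"] unfolding N_def by auto
  qed simp
  then have "\<beta> \<in># A" using d by simp
  then show False using \<Gamma> b sets[OF finite_antichain, of "\<lambda>\<gamma>. nat (z \<gamma>)"] unfolding A_def by blast
qed

text \<open>Pairwise obtuse vectors in an open half-space are independent, so there cannot be
  \<open>card S\<close> + 1 of them. Hence \<beta> has positive inner product with some \<gamma>,
  and of the two differences \<open>\<beta> - \<gamma>\<close> is excluded because \<beta> is
  low.\<close>

lemma below_complement:
  assumes b: "\<beta> \<in> below"
  shows "\<exists>\<gamma>\<in>\<Gamma>. \<gamma> - \<beta> \<in> below"
proof -
  have pos: "\<beta> \<in> pos" using b by (simp add: below_def)
  have notin: "\<beta> \<notin> \<Gamma>" using b Q_plus_0[of S] by (force simp: below_def)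
  have "\<exists>\<gamma>\<in>\<Gamma>. 0 < \<beta> \<bullet> \<gamma>"
  proof (rule ccontr)
    assume "\<not> ?thesis"
    then have "pairwise (\<lambda>a b. a \<bullet> b \<le> 0) (insert \<beta> \<Gamma>)"
      using antichain_obtuse by (auto simp: pairwise_insert inner_commute not_less)
    then have "independent (insert \<beta> \<Gamma>)"
      using height_pos antichain_pos pos finite_antichain
      by (intro obtuse_independent[of _ height_vec]) force+
    then have "card (insert \<beta> \<Gamma>) \<le> DIM('a)"
      using independent_bound by blast
    then show False using notin finite_antichain card_antichain card_S by simp
  qed
  then obtain \<gamma> where g: "\<gamma> \<in> \<Gamma>" "0 < \<beta> \<bullet> \<gamma>" by blast
  then have "\<beta> - \<gamma> \<in> pos \<or> \<gamma> - \<beta> \<in> pos"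
    using diff_root_cases[OF pos antichain_pos] notin by blast
  then have "\<gamma> - \<beta> \<in> pos" using b g by (auto simp: below_def positive_roots_def)
  then have "\<gamma> - \<beta> \<in> below"
    using antichain_minus_below[OF g(1), of "\<gamma> - \<beta>"] pos by simp
  then show ?thesis using g by blast
qed

text \<open>The values of \<open>x0\<close> at \<beta> and at its low partner add up to 1, and the
  partner's value is less than 1.\<close>

lemma x0_below_pos: "\<beta> \<in> below \<Longrightarrow> 0 < x0 \<bullet> \<beta>"
  using below_complement[of \<beta>] x0_below_less_1 x0_antichain by (force simp: inner_diff_right)

lemma x0_simple: "\<alpha> \<in> S \<Longrightarrow> 0 < x0 \<bullet> \<alpha>"
  using simple_not_below[of \<alpha>] x0_below_pos[of \<alpha>] x0_antichain[of \<alpha>] by fastforce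

lemma x0_Q_plus: "v \<in> Q_plus S \<Longrightarrow> 0 \<le> x0 \<bullet> v"
  using x0_simple by (force simp: Q_plus_def inner_sum_right intro!: sum_nonneg)

lemma x0_Q_plus_eq_0:
  assumes "v \<in> Q_plus S" "x0 \<bullet> v = 0"
  shows "v = 0"
proof (rule ccontr)
  assume "v \<noteq> 0"
  then obtain \<alpha> where a: "\<alpha> \<in> S" "v - \<alpha> \<in> Q_plus S" using Q_plus_minus_simple assms(1) by blast
  show False using x0_simple[OF a(1)] x0_Q_plus[OF a(2)] assms(2) by (simp add: inner_diff_right)
qed

section \<open>Minimality of \<open>x0\<close> and integrality of twice its values on roots\<close>

lemma x0_nonzero:
  assumes "\<beta> \<in> \<Delta>"
  shows "x0 \<bullet> \<beta> \<noteq> 0"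
proof
  assume 0: "x0 \<bullet> \<beta> = 0"
  have "\<beta> \<in> Q_plus S \<or> - \<beta> \<in> Q_plus S"
    using root_cases[OF assms] by (auto simp: positive_roots_def)
  then have "\<beta> = 0"
  proof
    assume "- \<beta> \<in> Q_plus S"
    moreover have "x0 \<bullet> (- \<beta>) = 0" using 0 by simp
    ultimately have "- \<beta> = 0" by (rule x0_Q_plus_eq_0)
    then show ?thesis by simp
  qed (use 0 x0_Q_plus_eq_0 in blast)
  then show False using root_nonzero[OF assms] by simp
qed

text \<open>By \<open>obtuse_coeff_nonneg\<close> the coefficients of \<open>x0\<close> in
  \<open>\<Gamma>\<close> are nonnegative, so replacing the values 1 by those of \<open>z\<close>
  gives \<open>x0 \<bullet> x0 \<le> z \<bullet> x0\<close>; for vectors of the same length this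
  means equality.\<close>

lemma x0_min:
  assumes z: "\<And>\<gamma>. \<gamma> \<in> \<Gamma> \<Longrightarrow> 1 \<le> z \<bullet> \<gamma>" and n: "z \<bullet> z = x0 \<bullet> x0"
  shows "z = x0"
proof -
  have "x0 \<in> span \<Gamma>" using span_antichain by simp
  then obtain t where t: "x0 = (\<Sum>\<gamma>\<in>\<Gamma>. t \<gamma> *\<^sub>R \<gamma>)"
    unfolding span_finite[OF finite_antichain] by auto
  have t0: "0 \<le> t \<gamma>" if "\<gamma> \<in> \<Gamma>" for \<gamma>
    using obtuse_coeff_nonneg[OF finite_antichain antichain_obtuse antichain_independent, of t \<gamma>]
      x0_antichain that unfolding t[symmetric] by simp
  have "x0 \<bullet> x0 = (\<Sum>\<gamma>\<in>\<Gamma>. t \<gamma> * (x0 \<bullet> \<gamma>))"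
    by (subst (2) t) (simp add: inner_sum_right)
  also have "\<dots> \<le> (\<Sum>\<gamma>\<in>\<Gamma>. t \<gamma> * (z \<bullet> \<gamma>))"
    using t0 z x0_antichain by (intro sum_mono mult_left_mono) auto
  also have "\<dots> = z \<bullet> x0"
    by (subst t) (simp add: inner_sum_right)
  finally have "(z - x0) \<bullet> (z - x0) \<le> 0"
    using n by (simp add: inner_diff_left inner_diff_right inner_commute)
  then show ?thesis by (metis inner_gt_zero_iff not_less right_minus_eq)
qed

text \<open>Take \<open>z\<close> in \<open>X\<close> with least inner product with
  \<open>x0\<close>. Reflecting \<open>z\<close> in \<gamma> cannot lower it, so
  \<open>z \<bullet> \<gamma> \<le> 0\<close>; this value is a nonzero integer, so
  \<open>- z\<close> satisfies the bounds of \<open>x0_min\<close> and \<open>z = - x0\<close>.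
  Members of \<open>X\<close> differ from \<open>x0\<close> by integers on roots, which gives the
  claim.\<close>

lemma double_x0_integer:
  assumes "\<beta> \<in> \<Delta>"
  shows "2 * (x0 \<bullet> \<beta>) \<in> \<int>"
proof -
  \<comment> \<open>A finite superset of the orbit of \<open>x0\<close> under the reflections in \<open>\<Gamma>\<close>.\<close>
  define X where "X = {z. z \<bullet> z = x0 \<bullet> x0 \<and>
    (\<forall>\<beta>\<in>\<Delta>. z \<bullet> \<beta> \<in> (\<lambda>\<beta>. x0 \<bullet> \<beta>) ` \<Delta> \<and> z \<bullet> \<beta> - x0 \<bullet> \<beta> \<in> \<int>)}"
  \<comment> \<open>A vector is determined by its values on the spanning set \<Delta>, and for
    members of \<open>X\<close> these come from a finite set.\<close>
  have "finite X"
  proof (rule finite_imageD)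
    show "finite ((\<lambda>z. restrict (\<lambda>\<beta>. z \<bullet> \<beta>) \<Delta>) ` X)"
      by (rule finite_subset[OF _ finite_PiE[OF finite_roots, of "\<lambda>_. (\<lambda>\<beta>. x0 \<bullet> \<beta>) ` \<Delta>"]])
         (use finite_roots in \<open>auto simp: X_def\<close>)
    show "inj_on (\<lambda>z. restrict (\<lambda>\<beta>. z \<bullet> \<beta>) \<Delta>) X"
    proof (rule inj_onI)
      fix y z assume eq: "restrict (\<lambda>\<beta>. y \<bullet> \<beta>) \<Delta> = restrict (\<lambda>\<beta>. z \<bullet> \<beta>) \<Delta>"
      have orth: "(y - z) \<bullet> \<beta> = 0" if "\<beta> \<in> \<Delta>" for \<beta>
        using that arg_cong[OF eq, of "\<lambda>f. f \<beta>"] by (simp add: inner_diff_left)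
      have "y - z \<in> span \<Delta>"
        using root_system by (simp add: root_system_def)
      then have "orthogonal (y - z) (y - z)"
        by (rule orthogonal_to_span) (simp add: orthogonal_def orth)
      then show "y = z" by (simp add: orthogonal_def)
    qed
  qed
  moreover have "X \<noteq> {}" unfolding X_def by auto
  ultimately obtain z where z: "z \<in> X" "\<And>y. y \<in> X \<Longrightarrow> z \<bullet> x0 \<le> y \<bullet> x0"
    using arg_min_if_finite[of X "\<lambda>z. z \<bullet> x0"] by (metis not_less)
  have "1 \<le> (- z) \<bullet> \<gamma>" if g: "\<gamma> \<in> \<Gamma>" for \<gamma>
  proof -
    have gD: "\<gamma> \<in> \<Delta>" using antichain_pos[OF g] by (simp add: positive_roots_def)
    then have gg: "0 < \<gamma> \<bullet> \<gamma>" using root_nonzero by simp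
    have zint: "z \<bullet> \<gamma> \<in> \<int>"
    proof -
      have "z \<bullet> \<gamma> - x0 \<bullet> \<gamma> \<in> \<int>" using z(1) gD by (simp add: X_def)
      from Ints_add[OF this Ints_1] show ?thesis by (simp add: x0_antichain[OF g])
    qed
    \<comment> \<open>On roots \<open>z\<close> takes only values that \<open>x0\<close> takes
      there, and those are nonzero.\<close>
    have zn: "z \<bullet> \<gamma> \<noteq> 0"
      using z(1) gD x0_nonzero by (auto simp: X_def)
    define y where "y = z - (2 * (z \<bullet> \<gamma>) / (\<gamma> \<bullet> \<gamma>)) *\<^sub>R \<gamma>"
    \<comment> \<open>Reflections are self-adjoint, so the values of \<open>y\<close> on roots are
      values of \<open>z\<close> on reflected roots.\<close>
    have yi: "y \<bullet> \<beta> = z \<bullet> (\<beta> - (2 * (\<beta> \<bullet> \<gamma>) / (\<gamma> \<bullet> \<gamma>)) *\<^sub>R \<gamma>)" for \<beta>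
      by (simp add: y_def inner_diff_left inner_diff_right inner_commute)
    have "y \<in> X"
      unfolding X_def
    proof (intro CollectI conjI ballI)
      show "y \<bullet> y = x0 \<bullet> x0"
        using z(1) gg by (simp add: X_def y_def inner_diff_left inner_diff_right inner_commute field_simps)
      fix \<beta> assume b: "\<beta> \<in> \<Delta>"
      show "y \<bullet> \<beta> \<in> (\<lambda>\<beta>. x0 \<bullet> \<beta>) ` \<Delta>"
        unfolding yi using z(1) reflect[OF gD b] unfolding X_def by blast
      have "y \<bullet> \<beta> - x0 \<bullet> \<beta> = (z \<bullet> \<beta> - x0 \<bullet> \<beta>) - (2 * (\<beta> \<bullet> \<gamma>) / (\<gamma> \<bullet> \<gamma>)) * (z \<bullet> \<gamma>)"
        unfolding yi by (simp add: inner_diff_right)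
      moreover have "z \<bullet> \<beta> - x0 \<bullet> \<beta> \<in> \<int>" using z(1) b by (simp add: X_def)
      ultimately show "y \<bullet> \<beta> - x0 \<bullet> \<beta> \<in> \<int>"
        using zint Cartan_integer[OF gD b] by (metis Ints_diff Ints_mult)
    qed
    then have "z \<bullet> x0 \<le> y \<bullet> x0" by (rule z(2))
    then have "(2 * (z \<bullet> \<gamma>) / (\<gamma> \<bullet> \<gamma>)) * (\<gamma> \<bullet> x0) \<le> 0"
      by (simp add: y_def inner_diff_left)
    then have "z \<bullet> \<gamma> \<le> 0"
      using gg x0_antichain[OF g] by (simp add: inner_commute[of \<gamma> x0] divide_le_0_iff)
    with zn zint show ?thesis by (auto elim!: Ints_cases)
  qed
  moreover have "(- z) \<bullet> (- z) = x0 \<bullet> x0" using z(1) by (simp add: X_def)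
  ultimately have "- z = x0" by (rule x0_min)
  have "z \<bullet> \<beta> - x0 \<bullet> \<beta> \<in> \<int>" using z(1) assms by (simp add: X_def)
  moreover have "z = - x0" using \<open>- z = x0\<close> by (metis minus_minus)
  ultimately have "- (2 * (x0 \<bullet> \<beta>)) \<in> \<int>" by simp
  then show ?thesis by (simp only: minus_in_Ints_iff)
qed

section \<open>Values on low roots and the edge count\<close>

lemma x0_below:
  assumes "\<beta> \<in> below"
  shows "x0 \<bullet> \<beta> = 1 / 2"
proof -
  obtain k :: int where "2 * (x0 \<bullet> \<beta>) = of_int k"
    using double_x0_integer[of \<beta>] assms by (auto simp: below_def positive_roots_def elim: Ints_cases)
  \<comment> \<open>The integer \<open>k\<close> lies strictly between 0 and 2.\<close>
  then show ?thesis
    using x0_below_pos[OF assms] x0_below_less_1[OF assms] by (cases "k = 1") auto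
qed

text \<open>A simple root dominated by \<gamma> is not in the antichain, hence low with value 1/2.
  Two of them split off from \<gamma> use up its value 1, and an element of \<open>Q_plus S\<close>
  on which \<open>x0\<close> vanishes is 0.\<close>

lemma nonsimple_antichain_sum:
  assumes g: "\<gamma> \<in> \<Gamma>" "\<gamma> \<notin> S"
  shows "\<exists>\<alpha>\<in>S - \<Gamma>. \<exists>\<beta>\<in>S - \<Gamma>. \<alpha> \<noteq> \<beta> \<and> \<alpha> + \<beta> = \<gamma>"
proof -
  have G: "\<gamma> \<in> Q_plus S" "\<gamma> \<in> \<Delta>"
    using antichain_pos[OF g(1)] by (simp_all add: positive_roots_def)
  have "\<gamma> \<noteq> 0" using root_nonzero[OF G(2)] .
  have *: "\<delta> \<notin> \<Gamma> \<and> x0 \<bullet> \<delta> = 1 / 2" if d: "\<delta> \<in> S" "\<gamma> - \<delta> \<in> Q_plus S" for \<delta>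
  proof -
    have "\<delta> \<notin> \<Gamma>" using antichain_diff[OF g(1) _ d(2)] d(1) g(2) by blast
    then show ?thesis using simple_not_below[OF d(1)] x0_below by blast
  qed
  obtain \<alpha> where a: "\<alpha> \<in> S" "\<gamma> - \<alpha> \<in> Q_plus S"
    using Q_plus_minus_simple[OF G(1) \<open>\<gamma> \<noteq> 0\<close>] by blast
  moreover have "\<gamma> - \<alpha> \<noteq> 0" using a g by auto
  ultimately obtain \<beta> where b: "\<beta> \<in> S" "\<gamma> - \<alpha> - \<beta> \<in> Q_plus S"
    using Q_plus_minus_simple by blast
  have "\<alpha> \<in> Q_plus S" using simple_pos[OF a(1)] by (simp add: positive_roots_def)
  \<comment> \<open>This lets \<open>*\<close> apply to \<beta> as well as to \<alpha>.\<close>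
  from Q_plus_add[OF b(2) this] have "\<gamma> - \<beta> \<in> Q_plus S" by (simp add: algebra_simps)
  note ab = *[OF a] *[OF b(1) this]
  then have "\<gamma> - \<alpha> - \<beta> = 0"
    using x0_antichain[OF g(1)] by (intro x0_Q_plus_eq_0[OF b(2)]) (simp add: inner_diff_right)
  then have sum: "\<alpha> + \<beta> = \<gamma>" by (simp add: algebra_simps)
  have "\<alpha> \<noteq> \<beta>"
  proof
    assume "\<alpha> = \<beta>"
    then have "2 *\<^sub>R \<alpha> \<in> \<Delta>" using sum G(2) by (simp add: scaleR_2)
    then show False using reduced a(1) simple_basis(1) unfolding reduced_def by fastforce
  qed
  then show ?thesis using a b ab sum by blast
qed

text \<open>Otherwise \<open>S - \<Gamma>\<close> is nonempty and has as many elements as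
  \<open>\<Gamma> - S\<close>, each of which gives an edge on \<open>S - \<Gamma>\<close>. The
  forest bound is proved metrically, through the Gram matrix of the unit vectors along these simple
  roots.\<close>

lemma simple_subset: "S \<subseteq> \<Gamma>"
proof (rule ccontr)
  assume "\<not> S \<subseteq> \<Gamma>"
  define T where "T = S - \<Gamma>"
  define e :: "'a \<Rightarrow> 'a" where "e a = a /\<^sub>R norm a" for a
  define F where "F = (\<lambda>(a, b). e a \<bullet> e b)"
  define P where "P = (\<lambda>\<gamma>. {(a, b). a \<in> T \<and> b \<in> T \<and> a \<noteq> b \<and> a + b = \<gamma>})"
  \<comment> \<open>The off-diagonal terms of the square norm of the sum of the \<open>e a\<close> are at most \<open>- 1 / 2\<close> for the two
    orderings of each edge, so too many edges make the square norm nonpositive.\<close>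
  define D where "D = (\<lambda>a. (a, a)) ` T"
  define U where "U = (\<Union>\<gamma>\<in>\<Gamma> - S. P \<gamma>)"
  have T: "T \<noteq> {}" "finite T" "T \<subseteq> S" using \<open>\<not> S \<subseteq> \<Gamma>\<close> simple_basis(3) by (auto simp: T_def)
  have "card (\<Gamma> - S) = card T"
    using card_antichain finite_antichain simple_basis(3) by (simp add: T_def card_Diff_subset_Int Int_commute)
  have ne: "norm a \<noteq> 0" if "a \<in> T" for a using that T(3) simple_basis(1) root_nonzero by auto
  have finP: "finite (P \<gamma>)" for \<gamma>
    by (rule finite_subset[of _ "T \<times> T"]) (use T in \<open>auto simp: P_def\<close>)
  have nonpos: "F p \<le> 0" if "p \<in> T \<times> T - D" for p
    using that simple_obtuse(2) T(3) by (auto simp: F_def D_def e_def intro!: mult_nonneg_nonpos)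
  have sum_D: "sum F D = real (card T)"
  proof -
    have "sum F D = (\<Sum>a\<in>T. F (a, a))"
      unfolding D_def by (subst sum.reindex) (auto simp: inj_on_def)
    also have "\<dots> = (\<Sum>a\<in>T. 1)"
      using ne by (intro sum.cong) (auto simp: F_def e_def dot_square_norm power2_eq_square field_simps)
    finally show ?thesis by simp
  qed
  have sum_P: "sum F (P \<gamma>) \<le> -1" if g: "\<gamma> \<in> \<Gamma> - S" for \<gamma>
  proof -
    obtain a b where ab: "a \<in> T" "b \<in> T" "a \<noteq> b" "a + b = \<gamma>"
      using nonsimple_antichain_sum[of \<gamma>] g by (auto simp: T_def)
    then have "{(a, b), (b, a)} \<subseteq> P \<gamma>" by (auto simp: P_def add.commute)
    then have "card {(a, b), (b, a)} \<le> card (P \<gamma>)" using finP card_mono by blast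
    then have c: "2 \<le> card (P \<gamma>)" using ab(3) by simp
    have "\<gamma> \<in> \<Delta>" using antichain_pos g by (auto simp: positive_roots_def)
    then have "F p \<le> - (1 / 2)" if "p \<in> P \<gamma>" for p
      using that simple_sum_inner T(3) unfolding P_def F_def e_def by auto
    then have "sum F (P \<gamma>) \<le> real (card (P \<gamma>)) * - (1 / 2)" by (rule sum_bounded_above)
    then show ?thesis using c by simp
  qed
  \<comment> \<open>The sets \<open>P \<gamma>\<close> are disjoint because a pair determines its
    sum.\<close>
  have "sum F U = (\<Sum>\<gamma>\<in>\<Gamma> - S. sum F (P \<gamma>))"
    unfolding U_def using finite_antichain finP by (intro sum.UNION_disjoint) (auto simp: P_def)
  also have "\<dots> \<le> (\<Sum>\<gamma>\<in>\<Gamma> - S. -1)" using sum_P by (rule sum_mono)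
  finally have sum_U: "sum F U \<le> - real (card T)" using \<open>card (\<Gamma> - S) = card T\<close> by simp
  have sub: "D \<union> U \<subseteq> T \<times> T" "D \<inter> U = {}" by (auto simp: D_def U_def P_def)
  have fins: "finite D" "finite U" using sub(1) T(2) finite_subset by blast+
  have "(\<Sum>a\<in>T. e a) \<bullet> (\<Sum>a\<in>T. e a) = sum F (T \<times> T)"
    by (simp add: inner_sum_left inner_sum_right sum.cartesian_product F_def sum.swap[of _ T T] inner_commute)
  also have "\<dots> = sum F (T \<times> T - (D \<union> U)) + sum F (D \<union> U)"
    using sub(1) T(2) by (intro sum.subset_diff) auto
  also have "sum F (D \<union> U) = sum F D + sum F U"
    using fins sub(2) by (rule sum.union_disjoint)
  also have "sum F (T \<times> T - (D \<union> U)) + (sum F D + sum F U) \<le> 0"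
    using sum_nonpos[of "T \<times> T - (D \<union> U)" F] nonpos sum_D sum_U by auto
  \<comment> \<open>The normalised simple roots sum to zero, a relation with nonzero coefficients
    among independent vectors.\<close>
  finally have "(\<Sum>a\<in>T. inverse (norm a) *\<^sub>R a) = 0"
    unfolding e_def by (metis inner_gt_zero_iff not_less)
  then have "inverse (norm a) = 0" if "a \<in> T" for a
    using that by (rule independentD[OF simple_basis(2) T(2,3), where u = "\<lambda>a. inverse (norm a)"])
  then show False using ne T(1) by auto
qed

lemma antichain_eq_simple: "\<Gamma> = S"
  using card_subset_eq[OF finite_antichain simple_subset] card_antichain by simp

end

theorem proposition2p10:
  fixes \<Delta> S \<Gamma> :: "'a::euclidean_space set"
  assumes "simple_lie_root_system \<Delta>"
    and "simple_roots \<Delta> S"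
    and "root_antichain \<Delta> S \<Gamma>"
  shows "independent \<Gamma> \<and> card \<Gamma> \<le> root_rank \<Delta> \<and>
         (card \<Gamma> = root_rank \<Delta> \<longrightarrow> \<Gamma> = S)"
proof -
  interpret antichain \<Delta> S \<Gamma>
    using assms by unfold_locales (auto simp: simple_lie_root_system_def)
  have rank: "root_rank \<Delta> = card S"
    using root_system card_S by (simp add: root_rank_def root_system_def)
  have "card \<Gamma> \<le> root_rank \<Delta>"
    using independent_bound[OF antichain_independent] by (simp add: rank card_S)
  moreover have "\<Gamma> = S" if "card \<Gamma> = root_rank \<Delta>"
  proof -
    interpret full_antichain \<Delta> S \<Gamma>
      using that rank by unfold_locales simp
    show ?thesis by (rule antichain_eq_simple)
  qed
  ultimately show ?thesis using antichain_independent by blast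
qed

end
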